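(* Let $k$ be a positive integer, and let $N$ be the maximum possible value of $n$ for which some simple connected graph of metric dimension at most $k$ contains the star $K_{1,n}$ as a subgraph. Then $$3^{k}-k-1 \leq N \leq 3^k-1.$$
   Context: All graphs are simple and connected. For vertices $u,v$ of a graph $G$, $d(u,v)$ is their distance in $G$. A set $S\subset V(G)$ is a resolving set for the vertices of $G$ if no two distinct vertices $u,v\in V(G)$ satisfy $d(u,s)=d(v,s)$ for all $s\in S$. The metric dimension $\dim(G)$ is the minimum size of a resolving set for the vertices of $G$. Subgraphs are not required to be induced. *)

theory Defs
  imports
    "Graph_Theory.Shortest_Path"
    "Graph_Theory.Kuratowski"
    "HOL-Library.Extended_Nat"
begin

text \<open>
  An undirected simple graph is a symmetric loopfree set of ordered pairs on its vertex set:
  \<^locale>\<open>pair_bidirected_digraph\<close>, or \<^locale>\<open>pair_graph\<close> if the graph is moreover finite.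
\<close>

definition simple_graphs :: "'a pair_pre_digraph set" where
  "simple_graphs = {G. pair_bidirected_digraph G}"

definition finite_simple_graphs :: "'a pair_pre_digraph set" where
  "finite_simple_graphs = {G. pair_graph G}"

text \<open>The cost of a walk for the constant weight 1 is its number of edges.\<close>

definition gdist :: "'a pair_pre_digraph \<Rightarrow> 'a \<Rightarrow> 'a \<Rightarrow> ereal" where
  "gdist G u v = wf_digraph.\<mu> (with_proj G) (\<lambda>_. 1) u v"

definition resolving_set :: "'a pair_pre_digraph \<Rightarrow> 'a set \<Rightarrow> bool" where
  "resolving_set G S \<longleftrightarrow> S \<subseteq> pverts G \<and>
     \<not> (\<exists>u \<in> pverts G. \<exists>v \<in> pverts G. u \<noteq> v \<and> (\<forall>s \<in> S. gdist G u s = gdist G v s))"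

text \<open>
  The value is \<^term>\<open>\<infinity>\<close> if there is no finite resolving set, which can only happen for
  infinite graphs; otherwise the infimum is a minimum.
\<close>

definition metric_dim :: "'a pair_pre_digraph \<Rightarrow> enat" where
  "metric_dim G = (INF S \<in> {S. resolving_set G S \<and> finite S}. enat (card S))"

definition contains_star :: "'a pair_pre_digraph \<Rightarrow> nat \<Rightarrow> bool" where
  "contains_star G n \<longleftrightarrow>
     (\<exists>H :: 'a pair_pre_digraph. subgraph (with_proj H) (with_proj G) \<and> K\<^bsub>1,n\<^esub> (with_proj H))"

definition star_sizes :: "'a pair_pre_digraph set \<Rightarrow> nat \<Rightarrow> nat set" where
  "star_sizes \<G> k =
     {n. \<exists>G \<in> \<G>. connected (with_proj G) \<and> metric_dim G \<le> enat k \<and> contains_star G n}"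

end

theory Submission
  imports Defs
begin

text \<open>
  In fact the maximum \<open>N\<close> equals the upper bound \<open>3 ^ k - 1\<close>.

  Upper bound (\<open>star_size_bound\<close>): moving along an edge changes the distance to a fixed vertex by
  at most 1. Relative to the centre of a star, each vertex of the star therefore has a vector of
  distance differences in \<open>{-1, 0, 1}\<close> indexed by the resolving set, and these vectors are distinct
  because the set resolves. So the star has at most \<open>3 ^ k\<close> vertices, the centre included.

  Lower bound (\<open>star_size_attained\<close>): take the \<open>k\<close>-dimensional king's graph on the cube
  \<open>{1, 2, 3} ^ k\<close> and add, for each coordinate \<open>i\<close>, one landmark \<open>(2, \<dots>, 2, 0, 2, \<dots>, 2)\<close> with the 0
  at position \<open>i\<close>; again two points are adjacent iff no coordinates differ by more than 1. The
  landmark for \<open>i\<close> is then adjacent exactly to the face \<open>x i = 1\<close> of the cube, and the distance of any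
  point to it is the \<open>i\<close>-th coordinate of that point: it is at least this because each step changes
  the coordinate by at most 1, and at most this because a step can always lower it
  (\<open>code_descent\<close>). Distances to the \<open>k\<close> landmarks are thus the coordinates themselves, so the
  landmarks resolve the graph, while the midpoint \<open>(2, \<dots>, 2)\<close> of the cube is adjacent to the
  \<open>3 ^ k - 1\<close> other points of the cube.
\<close>

section \<open>Distances as lengths of walks\<close>

context pair_wf_digraph
begin

lemma awalk_cost_const_1: "awalk_cost (\<lambda>_. 1) p = real (length p)"
  by (induct p) auto

lemma gdist_le_length:
  assumes "awalk u p v"
  shows "gdist G u v \<le> ereal (real (length p))"
  using min_cost_le_walk_cost[OF assms, of "\<lambda>_. 1"]
  by (simp add: gdist_def awalk_cost_const_1)

lemma gdist_greatest:
  assumes "\<And>p. awalk u p v \<Longrightarrow> x \<le> ereal (real (length p))"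
  shows "x \<le> gdist G u v"
  unfolding gdist_def \<mu>_def
  by (rule INF_greatest) (simp add: awalk_cost_const_1 assms)

lemma gdist_attained:
  assumes "u \<rightarrow>\<^sup>*\<^bsub>with_proj G\<^esub> v"
  obtains p where "awalk u p v" "gdist G u v = ereal (real (length p))"
proof -
  obtain q where "awalk u q v"
    using assms by (auto simp: reachable_awalk)
  then obtain p where p: "awalk u p v" "\<And>q. awalk u q v \<Longrightarrow> length p \<le> length q"
    using ex_has_least_nat[of "\<lambda>p. awalk u p v" q length] by blast
  have "gdist G u v = ereal (real (length p))"
    by (intro antisym gdist_le_length gdist_greatest) (use p in auto)
  then show thesis using that p(1) by blast
qed

text \<open>
  Following the descending arcs from \<open>u\<close> gives a walk of length \<open>f u\<close> that ends at \<open>s\<close>; no walk to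
  \<open>s\<close> is shorter, because \<open>f\<close> drops by at most 1 along each arc.
\<close>

lemma gdist_eq_potential:
  fixes f :: "'a \<Rightarrow> nat"
  assumes zero: "\<And>v. v \<in> pverts G \<Longrightarrow> f v = 0 \<longleftrightarrow> v = s"
    and drop: "\<And>u v. (u, v) \<in> parcs G \<Longrightarrow> f u \<le> Suc (f v)"
    and descent: "\<And>u t. u \<in> pverts G \<Longrightarrow> f u = Suc t \<Longrightarrow> \<exists>v. (u, v) \<in> parcs G \<and> f v = t"
    and u: "u \<in> pverts G"
  shows "gdist G u s = ereal (real (f u))"
proof (rule antisym)
  have "\<exists>p. awalk u p s \<and> length p = t" if "u \<in> pverts G" "f u = t" for u t
    using that
  proof (induction t arbitrary: u)
    case 0
    then show ?case using zero[of u] by (auto simp: awalk_Nil_iff)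
  next
    case (Suc t)
    then obtain v where v: "(u, v) \<in> parcs G" "f v = t"
      using descent by blast
    then obtain p where "awalk v p s" "length p = t"
      using Suc.IH[of v] by (auto dest: in_arcsD2)
    with v(1) show ?case
      by (intro exI[of _ "(u, v) # p"]) (simp add: awalk_Cons_iff)
  qed
  with u obtain p where "awalk u p s" "length p = f u" by blast
  then show "gdist G u s \<le> ereal (real (f u))"
    using gdist_le_length by metis
next
  have "f u \<le> length p" if "awalk u p s" for u p
    using that
  proof (induction p arbitrary: u)
    case Nil
    then show ?case using zero[of u] by (auto simp: awalk_Nil_iff)
  next
    case (Cons e p)
    then have "f (snd e) \<le> length p" "e \<in> parcs G" "u = fst e"
      by (auto simp: awalk_Cons_iff)
    then show ?case using drop[of "fst e" "snd e"] by simp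
  qed
  then show "ereal (real (f u)) \<le> gdist G u s"
    by (intro gdist_greatest) simp
qed

end

section \<open>The upper bound\<close>

text \<open>
  In a connected graph all distances are finite, so they can be taken as natural numbers, for which
  differences behave well.
\<close>

lemma (in pair_bidirected_digraph) nat_valued_gdist:
  assumes "connected G"
  obtains d :: "'a \<Rightarrow> 'a \<Rightarrow> nat"
  where "\<And>u v. u \<in> pverts G \<Longrightarrow> v \<in> pverts G \<Longrightarrow> gdist G u v = ereal (real (d u v))"
    and "\<And>u v s. (u, v) \<in> parcs G \<Longrightarrow> s \<in> pverts G \<Longrightarrow> d u s \<le> Suc (d v s)"
proof -
  have "strongly_connected G"
    by (rule symmetric_connected_imp_strongly_connected) (use sym_arcs assms in auto)
  then have reach: "u \<rightarrow>\<^sup>*\<^bsub>with_proj G\<^esub> v" if "u \<in> pverts G" "v \<in> pverts G" for u v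
    using that by (auto simp: strongly_connected_def)
  have "\<forall>u v. \<exists>p. u \<in> pverts G \<longrightarrow> v \<in> pverts G \<longrightarrow>
      awalk u p v \<and> gdist G u v = ereal (real (length p))"
    by (metis gdist_attained reach)
  then obtain P where P: "\<And>u v. u \<in> pverts G \<Longrightarrow> v \<in> pverts G \<Longrightarrow>
      awalk u (P u v) v \<and> gdist G u v = ereal (real (length (P u v)))"
    by metis
  show thesis
  proof (rule that[of "\<lambda>u v. length (P u v)"])
    fix u v s assume uv: "(u, v) \<in> parcs G" and s: "s \<in> pverts G"
    then have in_verts: "u \<in> pverts G" "v \<in> pverts G"
      by (auto dest: wellformed')
    have "awalk u ((u, v) # P v s) s"
      using uv P[OF in_verts(2) s] by (simp add: awalk_Cons_iff)
    from gdist_le_length[OF this] show "length (P u s) \<le> Suc (length (P v s))"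
      using P[OF in_verts(1) s] by simp
  qed (use P in auto)
qed

text \<open>
  The distance-difference vectors inject the closed star into \<open>{-1, 0, 1} ^ S\<close>. The centre, whose
  vector is 0, counts as well, which is where the 1 in \<open>3 ^ k - 1\<close> comes from.
\<close>

lemma star_size_bound:
  assumes "pair_bidirected_digraph G" "connected (with_proj G)"
    and S: "resolving_set G S" "finite S"
    and star: "contains_star G n"
  shows "Suc n \<le> 3 ^ card S"
proof (cases "n = 0")
  case True
  then show ?thesis by simp
next
  case False
  interpret pair_bidirected_digraph G by fact
  obtain H U V where H: "subgraph (with_proj H) (with_proj G)"
    and UV: "pverts H = U \<union> V" "U \<inter> V = {}" "card U = 1" "card V = n"
      "parcs H = U \<times> V \<union> V \<times> U"
    using star unfolding contains_star_def complete_bipartite_digraph_pair_def by blast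
  from \<open>card U = 1\<close> obtain c where c: "U = {c}"
    by (auto simp: card_1_singleton_iff)
  have V: "finite V"
    using UV(4) False card_ge_0_finite by blast
  have star_verts: "insert c V \<subseteq> pverts G"
    using H UV(1) c by (auto simp: subgraph_def)
  have star_arcs: "(c, v) \<in> parcs G" "(v, c) \<in> parcs G" if "v \<in> V" for v
    using H UV(5) c that by (auto simp: subgraph_def)
  obtain d :: "'a \<Rightarrow> 'a \<Rightarrow> nat"
    where d: "\<And>u v. u \<in> pverts G \<Longrightarrow> v \<in> pverts G \<Longrightarrow> gdist G u v = ereal (real (d u v))"
      and d_step: "\<And>u v s. (u, v) \<in> parcs G \<Longrightarrow> s \<in> pverts G \<Longrightarrow> d u s \<le> Suc (d v s)"
    using nat_valued_gdist[OF assms(2)] by blast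
  have S_verts: "S \<subseteq> pverts G"
    using S(1) by (simp add: resolving_set_def)
  define \<phi> where "\<phi> v = (\<lambda>s\<in>S. int (d v s) - int (d c s))" for v
  have "inj_on \<phi> (insert c V)"
  proof (rule inj_onI)
    fix u v assume uv: "u \<in> insert c V" "v \<in> insert c V" and eq: "\<phi> u = \<phi> v"
    have "gdist G u s = gdist G v s" if "s \<in> S" for s
    proof -
      have "d u s = d v s"
        using fun_cong[OF eq, of s] that by (simp add: \<phi>_def)
      then show ?thesis
        using d uv that star_verts S_verts by (metis subsetD)
    qed
    then show "u = v"
      using S(1) uv star_verts unfolding resolving_set_def by blast
  qed
  moreover have "\<phi> ` insert c V \<subseteq> S \<rightarrow>\<^sub>E {-1, 0, 1}"
  proof
    fix x assume "x \<in> \<phi> ` insert c V"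
    then obtain v where v: "v \<in> insert c V" "x = \<phi> v" by blast
    have "int (d v s) - int (d c s) \<in> {-1, 0, 1}" if "s \<in> S" for s
    proof -
      have "d v s \<le> Suc (d c s) \<and> d c s \<le> Suc (d v s)"
        using v(1) star_arcs d_step that S_verts by (cases "v = c") auto
      then show ?thesis by auto
    qed
    then show "x \<in> S \<rightarrow>\<^sub>E {-1, 0, 1}"
      using v(2) by (auto simp: \<phi>_def)
  qed
  ultimately have "card (insert c V) \<le> card (S \<rightarrow>\<^sub>E {-1, 0, 1 :: int})"
    using S(2) by (intro card_inj_on_le) (auto intro: finite_PiE)
  also have "\<dots> = 3 ^ card S"
    using S(2) by (simp add: card_PiE numeral_3_eq_3)
  finally show ?thesis
    using V UV c by simp
qed

lemma metric_dim_le_iff: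
  "metric_dim G \<le> enat k \<longleftrightarrow> (\<exists>S. resolving_set G S \<and> finite S \<and> card S \<le> k)"
proof
  assume "metric_dim G \<le> enat k"
  then have "metric_dim G < enat (Suc k)"
    by (metis enat_ord_simps(2) lessI order_le_less_trans)
  then show "\<exists>S. resolving_set G S \<and> finite S \<and> card S \<le> k"
    by (auto simp: metric_dim_def INF_less_iff less_Suc_eq_le)
next
  assume "\<exists>S. resolving_set G S \<and> finite S \<and> card S \<le> k"
  then show "metric_dim G \<le> enat k"
    by (auto simp: metric_dim_def intro: INF_lower2)
qed

section \<open>The king's graph with landmarks\<close>

text \<open>
  The entries 2 put the landmark within one step of its whole face of the cube, and the entry 0
  keeps distinct landmarks at distance 2, as their coordinates demand.
\<close>

definition landmark :: "nat \<Rightarrow> nat \<Rightarrow> nat \<Rightarrow> nat" where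
  "landmark k i = (\<lambda>j\<in>{..<k}. if j = i then 0 else 2)"

definition cube :: "nat \<Rightarrow> (nat \<Rightarrow> nat) set" where
  "cube k = {..<k} \<rightarrow>\<^sub>E {1, 2, 3}"

definition codes :: "nat \<Rightarrow> (nat \<Rightarrow> nat) set" where
  "codes k = cube k \<union> landmark k ` {..<k}"

definition king_adjacent :: "nat \<Rightarrow> (nat \<Rightarrow> nat) \<Rightarrow> (nat \<Rightarrow> nat) \<Rightarrow> bool" where
  "king_adjacent k p q \<longleftrightarrow> p \<noteq> q \<and> (\<forall>i<k. p i \<le> Suc (q i) \<and> q i \<le> Suc (p i))"

text \<open>
  The vertices are elements of an arbitrary type that are labelled with points by \<open>c\<close>; this allows
  the graph to be built on any sufficiently large type.
\<close>

definition king_graph :: "nat \<Rightarrow> 'a set \<Rightarrow> ('a \<Rightarrow> nat \<Rightarrow> nat) \<Rightarrow> 'a pair_pre_digraph" where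
  "king_graph k A c =
     \<lparr>pverts = A, parcs = {(a, b). a \<in> A \<and> b \<in> A \<and> king_adjacent k (c a) (c b)}\<rparr>"

lemma king_adjacent_sym: "king_adjacent k p q \<longleftrightarrow> king_adjacent k q p"
  by (auto simp: king_adjacent_def)

lemma finite_cube: "finite (cube k)"
  by (auto simp: cube_def intro: finite_PiE)

lemma card_cube: "card (cube k) = 3 ^ k"
  by (simp add: cube_def card_PiE numeral_3_eq_3)

lemma finite_codes: "finite (codes k)"
  by (simp add: codes_def finite_cube)

lemma codes_extensional: "p \<in> codes k \<Longrightarrow> p \<in> extensional {..<k}"
  by (auto simp: codes_def cube_def landmark_def PiE_def)

lemma codes_eqI:
  assumes "p \<in> codes k" "q \<in> codes k" "\<And>i. i < k \<Longrightarrow> p i = q i"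
  shows "p = q"
  using assms by (intro extensionalityI[of p "{..<k}" q] codes_extensional) auto

lemma landmark_in_codes: "i < k \<Longrightarrow> landmark k i \<in> codes k"
  by (simp add: codes_def)

lemma code_eq_0_iff:
  assumes "p \<in> codes k" "i < k"
  shows "p i = 0 \<longleftrightarrow> p = landmark k i"
proof
  assume "p i = 0"
  moreover have "p i \<noteq> 0" if "p \<in> cube k"
    using PiE_mem[OF that[unfolded cube_def], of i] assms(2) by auto
  ultimately obtain j where "p = landmark k j"
    using assms(1) by (auto simp: codes_def)
  with \<open>p i = 0\<close> assms(2) show "p = landmark k i"
    by (simp add: landmark_def split: if_splits)
qed (use assms(2) in \<open>simp add: landmark_def\<close>)

lemma code_le_3:
  assumes "p \<in> codes k" "i < k"
  shows "p i \<le> 3"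
  using assms by (auto simp: codes_def cube_def landmark_def dest!: PiE_mem)

text \<open>
  From coordinate 1 the landmark itself is one step away, since every other coordinate of a cube
  point differs by at most 1 from 2. From a larger coordinate, lower it and raise every 0 to a 1:
  this is a single step, and it stays in the cube or, from another landmark, enters it.
\<close>

lemma code_descent:
  assumes p: "p \<in> codes k" and i: "i < k" and t: "p i = Suc t"
  shows "\<exists>q \<in> codes k. king_adjacent k p q \<and> q i = t"
proof (cases "t = 0")
  case True
  then have "p i = 1" using t by simp
  then have "p \<in> cube k"
    using p i by (auto simp: codes_def landmark_def split: if_splits)
  then have "p j \<in> {1, 2, 3}" if "j < k" for j
    using that by (auto simp: cube_def dest: PiE_mem)
  then have "king_adjacent k p (landmark k i)"
    using i \<open>p i = 1\<close> by (fastforce simp: king_adjacent_def landmark_def)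
  moreover have "landmark k i i = t"
    using i True by (simp add: landmark_def)
  ultimately show ?thesis
    using landmark_in_codes[OF i] by blast
next
  case False
  define q where "q = (\<lambda>j\<in>{..<k}. if j = i then t else max 1 (p j))"
  have "q \<in> cube k"
    unfolding cube_def
  proof (rule PiE_I)
    fix j assume "j \<in> {..<k}"
    then have "q j \<le> 3" "q j \<ge> 1"
      using code_le_3[OF p, of j] code_le_3[OF p i] t False by (auto simp: q_def)
    then show "q j \<in> {1, 2, 3}" by auto
  qed (simp add: q_def)
  moreover have "q i = t"
    using i by (simp add: q_def)
  moreover have "p \<noteq> q"
    using t \<open>q i = t\<close> by auto
  then have "king_adjacent k p q"
    using t by (auto simp: king_adjacent_def q_def)
  ultimately show ?thesis
    by (auto simp: codes_def)
qed

locale labelled_codes =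
  fixes k :: nat and A :: "'a set" and c :: "'a \<Rightarrow> nat \<Rightarrow> nat"
  assumes label: "bij_betw c A (codes k)"
    and k_pos: "k \<ge> 1"
begin

abbreviation G where "G \<equiv> king_graph k A c"

lemma label_in_codes: "a \<in> A \<Longrightarrow> c a \<in> codes k"
  using label by (auto simp: bij_betw_def)

lemma label_inj: "a \<in> A \<Longrightarrow> b \<in> A \<Longrightarrow> c a = c b \<longleftrightarrow> a = b"
  using label by (auto simp: bij_betw_def inj_on_def)

lemma label_surj: "p \<in> codes k \<Longrightarrow> \<exists>a \<in> A. c a = p"
  using label by (metis bij_betw_imp_surj_on imageE)

sublocale king: pair_graph G
proof
  show "finite (pverts G)"
    using label finite_codes by (auto simp: king_graph_def bij_betw_finite)
  moreover have "parcs G \<subseteq> pverts G \<times> pverts G"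
    by (auto simp: king_graph_def)
  ultimately show "finite (parcs G)"
    by (meson finite_SigmaI finite_subset)
  show "symmetric (with_proj G)"
    by (auto simp: symmetric_def king_graph_def king_adjacent_sym intro!: symI)
qed (auto simp: king_graph_def king_adjacent_def)

lemma gdist_landmark:
  assumes "a \<in> A" "s \<in> A" "c s = landmark k i" "i < k"
  shows "gdist G a s = ereal (real (c a i))"
proof (rule king.gdist_eq_potential)
  show "c v i = 0 \<longleftrightarrow> v = s" if "v \<in> pverts G" for v
    using that assms code_eq_0_iff[OF label_in_codes, of v i] label_inj[of v s]
    by (simp add: king_graph_def)
  show "c u i \<le> Suc (c v i)" if "(u, v) \<in> parcs G" for u v
    using that assms(4) by (simp add: king_graph_def king_adjacent_def)
  show "\<exists>v. (u, v) \<in> parcs G \<and> c v i = t" if u: "u \<in> pverts G" "c u i = Suc t" for u t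
  proof -
    have "u \<in> A" using u by (simp add: king_graph_def)
    then obtain q where "q \<in> codes k" "king_adjacent k (c u) q" "q i = t"
      using code_descent[OF label_in_codes assms(4) u(2)] by blast
    then show ?thesis
      using label_surj[of q] \<open>u \<in> A\<close> by (auto simp: king_graph_def)
  qed
qed (use assms in \<open>simp add: king_graph_def\<close>)

lemma king_connected: "connected (with_proj G)"
proof -
  obtain s where s: "s \<in> A" "c s = landmark k 0"
    using label_surj[OF landmark_in_codes[of 0 k]] k_pos by auto
  have to_s: "a \<rightarrow>\<^sup>*\<^bsub>with_proj G\<^esub> s" if "a \<in> A" for a
  proof -
    have "gdist G a s < \<infinity>"
      using gdist_landmark[OF that s] k_pos by simp
    then show ?thesis
      by (simp only: gdist_def king.\<mu>_reach_conv)
  qed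
  have "a \<rightarrow>\<^sup>*\<^bsub>with_proj G\<^esub> b" if "a \<in> A" "b \<in> A" for a b
    using to_s[OF that(1)] symmetric_reachable[OF king.sym_arcs to_s[OF that(2)]]
    by (rule king.reachable_trans)
  then have "a \<rightarrow>\<^sup>*\<^bsub>with_proj (mk_symmetric G)\<^esub> b" if "a \<in> A" "b \<in> A" for a b
    using that by (simp add: king.reachable_mk_symmetric_eq king.sym_arcs)
  then show ?thesis
    using s(1) by (auto simp: connected_def strongly_connected_def king_graph_def mk_symmetric_def)
qed

lemma king_metric_dim: "metric_dim G \<le> enat k"
proof -
  have "\<forall>i. \<exists>s. i < k \<longrightarrow> s \<in> A \<and> c s = landmark k i"
    using label_surj landmark_in_codes by blast
  then obtain s where s: "\<And>i. i < k \<Longrightarrow> s i \<in> A \<and> c (s i) = landmark k i"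
    by metis
  have "resolving_set G (s ` {..<k})"
    unfolding resolving_set_def
  proof (intro conjI notI)
    show "s ` {..<k} \<subseteq> pverts G"
      using s by (auto simp: king_graph_def)
  next
    assume "\<exists>u\<in>pverts G. \<exists>v\<in>pverts G. u \<noteq> v \<and> (\<forall>x\<in>s ` {..<k}. gdist G u x = gdist G v x)"
    then obtain u v where uv: "u \<in> A" "v \<in> A" "u \<noteq> v"
      and eq: "\<And>i. i < k \<Longrightarrow> gdist G u (s i) = gdist G v (s i)"
      by (auto simp: king_graph_def)
    have "c u i = c v i" if "i < k" for i
      using eq[OF that] gdist_landmark[OF uv(1), of "s i" i] gdist_landmark[OF uv(2), of "s i" i]
        s[OF that] that by simp
    then have "c u = c v"
      using uv label_in_codes by (blast intro: codes_eqI)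
    then show False
      using uv label_inj by blast
  qed
  moreover have "card (s ` {..<k}) \<le> k"
    using card_image_le[of "{..<k}" s] by simp
  ultimately show ?thesis
    unfolding metric_dim_le_iff by blast
qed

lemma king_contains_star: "contains_star G (3 ^ k - 1)"
proof -
  define mid where "mid = (\<lambda>i\<in>{..<k}. 2 :: nat)"
  have mid: "mid \<in> cube k"
    by (auto simp: mid_def cube_def)
  then obtain z where z: "z \<in> A" "c z = mid"
    using label_surj by (auto simp: codes_def)
  define V where "V = {a \<in> A. c a \<in> cube k - {mid}}"
  have "c ` V = cube k - {mid}"
    using label_surj by (fastforce simp: V_def codes_def)
  then have "bij_betw c V (cube k - {mid})"
    by (intro bij_betw_subset[OF label]) (auto simp: V_def)
  then have card_V: "card V = 3 ^ k - 1" and fin_V: "finite V"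
    using mid finite_cube[of k]
    by (simp_all add: bij_betw_same_card bij_betw_finite card_Diff_singleton card_cube)
  define H where "H = \<lparr>pverts = insert z V, parcs = {z} \<times> V \<union> V \<times> {z}\<rparr>"
  have "king_adjacent k mid (c v)" if "v \<in> V" for v
  proof -
    have "c v i \<in> {1, 2, 3}" if "i < k" for i
      using \<open>v \<in> V\<close> that by (auto simp: V_def cube_def dest: PiE_mem)
    then show ?thesis
      using \<open>v \<in> V\<close> by (fastforce simp: V_def king_adjacent_def mid_def)
  qed
  then have arcs: "parcs H \<subseteq> parcs G"
    using z by (auto simp: H_def V_def king_graph_def king_adjacent_sym)
  have "pair_wf_digraph H"
    by unfold_locales (auto simp: H_def)
  then have "subgraph (with_proj H) (with_proj G)"
    using arcs z king.wf_digraph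
    by (auto simp: subgraph_def wf_digraph_wp_iff H_def V_def king_graph_def)
  moreover have "K\<^bsub>1,3 ^ k - 1\<^esub> (with_proj H)"
    unfolding complete_bipartite_digraph_pair_def
  proof (intro conjI exI)
    show "{z} \<inter> V = {}"
      using z by (auto simp: V_def)
  qed (use fin_V card_V in \<open>auto simp: H_def\<close>)
  ultimately show ?thesis
    unfolding contains_star_def by blast
qed

end

lemma star_size_attained:
  assumes "infinite (UNIV :: 'a set)" "k \<ge> 1"
  obtains G :: "'a pair_pre_digraph"
  where "pair_graph G" "connected (with_proj G)" "metric_dim G \<le> enat k"
    "contains_star G (3 ^ k - 1)"
proof -
  obtain A :: "'a set" where "finite A" "card A = card (codes k)"
    using infinite_arbitrarily_large[OF assms(1)] by blast
  then obtain c where "bij_betw c A (codes k)"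
    using finite_same_card_bij finite_codes by blast
  then interpret labelled_codes k A c
    using assms(2) by unfold_locales
  show thesis
    using that king.pair_graph king_connected king_metric_dim king_contains_star by blast
qed

section \<open>The extremal star size\<close>

theorem theorem3p3:
  fixes k :: nat
    and \<G> :: "'a pair_pre_digraph set"
  assumes "infinite (UNIV :: 'a set)"
    and "\<G> = simple_graphs \<or> \<G> = finite_simple_graphs"
    and "k \<ge> 1"
  shows "\<exists>N :: nat. N \<in> star_sizes \<G> k \<and> (\<forall>n \<in> star_sizes \<G> k. n \<le> N) \<and>
           (3 :: int) ^ k - int k - 1 \<le> int N \<and> int N \<le> (3 :: int) ^ k - 1"
proof (intro exI[of _ "3 ^ k - 1"] conjI ballI)
  have \<G>: "finite_simple_graphs \<subseteq> \<G>" "\<G> \<subseteq> simple_graphs"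
  proof -
    have "pair_bidirected_digraph G" if "pair_graph G" for G :: "'a pair_pre_digraph"
    proof -
      interpret pair_graph G by fact
      show ?thesis by unfold_locales
    qed
    then show "finite_simple_graphs \<subseteq> \<G>" "\<G> \<subseteq> simple_graphs"
      using assms(2) by (auto simp: simple_graphs_def finite_simple_graphs_def)
  qed
  show "3 ^ k - 1 \<in> star_sizes \<G> k"
    using star_size_attained[OF assms(1,3)] \<G>(1)
    unfolding star_sizes_def finite_simple_graphs_def by blast
  fix n assume "n \<in> star_sizes \<G> k"
  then obtain G :: "'a pair_pre_digraph" and S
    where "pair_bidirected_digraph G" "connected (with_proj G)"
    "contains_star G n" "resolving_set G S" "finite S" and S: "card S \<le> k"
    using \<G>(2) unfolding star_sizes_def simple_graphs_def metric_dim_le_iff by blast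
  then have "Suc n \<le> 3 ^ card S"
    by (intro star_size_bound)
  also have "\<dots> \<le> 3 ^ k"
    using S by (intro power_increasing) auto
  finally show "n \<le> 3 ^ k - 1" by simp
qed simp_all

end
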